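(* There is a planar graph $G$ with $\operatorname{pn}_\ell(G) = 3$.
   Context: All graphs are finite and simple. A linear embedding of a graph $G=(V,E)$ is a pair $(\prec,\mathcal{P})$ where $\prec$ is a total ordering of $V$ and $\mathcal{P}$ is a partition of $E$ into parts called pages. Two edges $uv, xy$ with $u\prec v$, $x \prec y$ cross if $u \prec x \prec v \prec y$ or $x \prec u \prec y \prec v$. A book embedding is a linear embedding in which no two crossing edges lie on the same page. For a book embedding and a vertex $v$, let $\mathcal{P}_v$ be the set of pages containing at least one edge incident to $v$; the embedding is $k$-local if $|\mathcal{P}_v| \le k$ for all vertices $v$. The local page number $\operatorname{pn}_\ell(G)$ is the smallest $k$ such that $G$ admits a $k$-local book embedding (with any number of pages). *)

theory Defs
  imports "HOL-Analysis.Analysis"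
begin

definition simple_graph :: "'a set \<Rightarrow> 'a set set \<Rightarrow> bool" where
  "simple_graph V E \<longleftrightarrow> finite V \<and> (\<forall>e\<in>E. e \<subseteq> V \<and> card e = 2)"

definition planar :: "'a set \<Rightarrow> 'a set set \<Rightarrow> bool" where
  "planar V E \<longleftrightarrow> (\<exists>(pos :: 'a \<Rightarrow> complex) (\<gamma> :: 'a set \<Rightarrow> real \<Rightarrow> complex).
     inj_on pos V \<and>
     (\<forall>e\<in>E. arc (\<gamma> e) \<and> {pathstart (\<gamma> e), pathfinish (\<gamma> e)} = pos ` e \<and>
              path_image (\<gamma> e) \<inter> pos ` V = pos ` e) \<and>
     (\<forall>e\<in>E. \<forall>f\<in>E. e \<noteq> f \<longrightarrow> path_image (\<gamma> e) \<inter> path_image (\<gamma> f) \<subseteq> pos ` (e \<inter> f)))"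

definition crossing :: "('a \<Rightarrow> nat) \<Rightarrow> 'a set \<Rightarrow> 'a set \<Rightarrow> bool" where
  "crossing ord e f \<longleftrightarrow> (\<exists>u v x y. e = {u, v} \<and> f = {x, y} \<and> ord u < ord v \<and> ord x < ord y \<and>
     ((ord u < ord x \<and> ord x < ord v \<and> ord v < ord y) \<or>
      (ord x < ord u \<and> ord u < ord y \<and> ord y < ord v)))"

text \<open>A book embedding: a total order on V (an injective rank function) and a partition
  of E into pages (given by a page label for each edge; the pages are the nonempty fibres),
  such that no two crossing edges lie on the same page.\<close>
definition book_embedding :: "'a set \<Rightarrow> 'a set set \<Rightarrow> ('a \<Rightarrow> nat) \<Rightarrow> ('a set \<Rightarrow> nat) \<Rightarrow> bool" where
  "book_embedding V E ord page \<longleftrightarrow> inj_on ord V \<and>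
     (\<forall>e\<in>E. \<forall>f\<in>E. crossing ord e f \<longrightarrow> page e \<noteq> page f)"

definition pages_at :: "'a set set \<Rightarrow> ('a set \<Rightarrow> nat) \<Rightarrow> 'a \<Rightarrow> nat set" where
  "pages_at E page v = page ` {e\<in>E. v \<in> e}"

definition k_local_book_embedding :: "nat \<Rightarrow> 'a set \<Rightarrow> 'a set set \<Rightarrow> ('a \<Rightarrow> nat) \<Rightarrow> ('a set \<Rightarrow> nat) \<Rightarrow> bool" where
  "k_local_book_embedding k V E ord page \<longleftrightarrow> book_embedding V E ord page \<and>
     (\<forall>v\<in>V. card (pages_at E page v) \<le> k)"

definition local_page_number :: "'a set \<Rightarrow> 'a set set \<Rightarrow> nat" where
  "local_page_number V E = (LEAST k. \<exists>ord page. k_local_book_embedding k V E ord page)"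

end

theory Submission
  imports Defs
begin

text \<open>
  Putting one additional edge on a new page raises the local page number by at most one. Hence it
  suffices to find a planar graph without a 2-local book embedding: some subgraph obtained by
  deleting edges then has local page number exactly 3.

  In a 2-local book embedding every \<open>K\<^sub>4\<close> contains two vertices \<open>x\<close>, \<open>y\<close> whose edges use only two
  pages altogether. Among the common neighbours of \<open>x\<close> and \<open>y\<close> in one of the two arcs between them,
  all but the outermost ones have their edge to \<open>x\<close> on one of these pages and their edge to \<open>y\<close> on
  the other, so these edges fence in every vertex further inside. If two adjacent common neighbours
  \<open>u\<close>, \<open>v\<close> are both fenced in, then any common neighbour \<open>d\<close> of \<open>u, v, x\<close> and any common neighbour
  \<open>e\<close> of \<open>u, v, y\<close> lie between \<open>u\<close> and \<open>v\<close>, so the edge \<open>uv\<close> crosses \<open>xd\<close> and \<open>ye\<close>, which occupy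
  both pages available to \<open>u\<close>.

  A suitable planar graph arises from a triangle by repeatedly placing a new vertex inside a
  triangular face and joining it to the three corners; such graphs have straight-line drawings.
\<close>

section \<open>Straight-line drawings of stacked triangles\<close>

text \<open>A face of \<open>C\<close> cuts the smaller polytope \<open>convex hull U\<close> in one
  of its own faces, and every face of a polytope is spanned by some of the generators; these then
  lie in \<open>U \<inter> F\<close>.\<close>

lemma convex_hull_Int_face:
  fixes U :: "'a::euclidean_space set"
  assumes "finite U" and F: "F face_of C" and sub: "convex hull U \<subseteq> C"
  shows "convex hull U \<inter> F = convex hull (U \<inter> F)"
proof
  have "F \<inter> convex hull U face_of C \<inter> convex hull U"
    using F by (rule face_of_slice) simp
  moreover have "C \<inter> convex hull U = convex hull U"
    using sub by blast
  ultimately have "convex hull U \<inter> F face_of convex hull U"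
    by (simp add: Int_commute)
  then obtain U' where U': "U' \<subseteq> U" "convex hull U \<inter> F = convex hull U'"
    using face_of_convex_hull_subset finite_imp_compact[OF \<open>finite U\<close>] by blast
  have "U' \<subseteq> convex hull U'"
    by (rule hull_subset)
  then have "U' \<subseteq> U \<inter> F"
    using U' by blast
  then show "convex hull U \<inter> F \<subseteq> convex hull (U \<inter> F)"
    using U'(2) by (simp add: hull_mono)
  have "convex F"
    using F face_of_imp_convex by blast
  then show "convex hull (U \<inter> F) \<subseteq> convex hull U \<inter> F"
    by (simp add: hull_minimal hull_mono)
qed

text \<open>Affine independence keeps each point of \<open>S\<close> out of the affine hull of the
  others, so only members of \<open>T\<close> can lie in the hull of \<open>T\<close>.\<close>

lemma affine_independent_Int_convex_hull:
  assumes ind: "\<not> affine_dependent S" and "T \<subseteq> S" "U \<subseteq> S"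
  shows "U \<inter> convex hull T = U \<inter> T"
proof -
  have "a \<in> T" if "a \<in> U" "a \<in> convex hull T" for a
  proof (rule ccontr)
    assume "a \<notin> T"
    then have "T \<subseteq> S - {a}"
      using \<open>T \<subseteq> S\<close> by blast
    then have "convex hull T \<subseteq> affine hull (S - {a})"
      by (rule order_trans[OF convex_hull_subset_affine_hull hull_mono])
    then show False
      using ind that \<open>U \<subseteq> S\<close> by (auto simp: affine_dependent_def)
  qed
  then show ?thesis
    by (auto intro: hull_inc)
qed

text \<open>The geometric condition on a simplicial complex of dimension at most two in the plane.
  With the singletons in \<open>K\<close>, the last clause also keeps the vertices apart and forbids
  an edge to run through a foreign vertex.\<close>

definition realizes :: "('a \<Rightarrow> complex) \<Rightarrow> 'a set set \<Rightarrow> bool" where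
  "realizes pos K \<longleftrightarrow>
     (\<forall>v\<in>\<Union>K. {v} \<in> K) \<and>
     (\<forall>s\<in>K. finite s \<and> card s \<le> 3 \<and> \<not> affine_dependent (pos ` s)) \<and>
     (\<forall>s\<in>K. \<forall>t\<in>K. convex hull (pos ` s) \<inter> convex hull (pos ` t) \<subseteq> convex hull (pos ` (s \<inter> t)))"

lemma realizes_inj_on:
  assumes "realizes pos K"
  shows "inj_on pos (\<Union>K)"
proof (rule inj_onI)
  fix u v assume uv: "u \<in> \<Union>K" "v \<in> \<Union>K" "pos u = pos v"
  then have "{u} \<in> K" "{v} \<in> K"
    using assms unfolding realizes_def by blast+
  then have "convex hull (pos ` {u}) \<inter> convex hull (pos ` {v}) \<subseteq> convex hull (pos ` ({u} \<inter> {v}))"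
    using assms unfolding realizes_def by blast
  moreover have "pos v \<in> convex hull (pos ` {u}) \<inter> convex hull (pos ` {v})"
    using uv(3) by simp
  ultimately have "{u} \<inter> {v} \<noteq> {}"
    by (metis convex_hull_empty empty_iff image_empty subsetD)
  then show "u = v"
    by blast
qed

text \<open>This is stellar subdivision: \<open>t\<close> is replaced by the cones from
  \<open>w\<close> over its proper subsets, the empty one giving \<open>{w}\<close>. Any point in
  the relative interior of the triangle can serve as apex.\<close>

lemma realizes_stack:
  assumes K: "realizes pos K" and t: "t \<in> K" "card t = 3" and w: "w \<notin> \<Union>K"
  shows "\<exists>p. realizes (pos(w := p)) (K - {t} \<union> insert w ` {s. s \<subset> t})"
proof -
  have K1: "\<And>v. v \<in> \<Union>K \<Longrightarrow> {v} \<in> K"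
    and K2: "\<And>s. s \<in> K \<Longrightarrow> finite s \<and> card s \<le> 3 \<and> \<not> affine_dependent (pos ` s)"
    and K3: "\<And>s t. s \<in> K \<Longrightarrow> t \<in> K \<Longrightarrow>
      convex hull (pos ` s) \<inter> convex hull (pos ` t) \<subseteq> convex hull (pos ` (s \<inter> t))"
    using K unfolding realizes_def by blast+
  have inj: "inj_on pos (\<Union>K)"
    using K by (rule realizes_inj_on)
  have ft: "finite t" and ind: "\<not> affine_dependent (pos ` t)"
    using K2[OF t(1)] by blast+
  have injt: "inj_on pos t"
    using inj t(1) by (auto intro: inj_on_subset)
  have "t \<noteq> {}"
    using t(2) by auto
  then have "rel_interior (convex hull (pos ` t)) \<noteq> {}"
    by (simp add: rel_interior_eq_empty)
  then obtain p where p: "p \<in> rel_interior (convex hull (pos ` t))"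
    by blast
  then have pt: "p \<in> convex hull (pos ` t)"
    using rel_interior_subset by blast
  define pos' where "pos' = pos(w := p)"
  have old: "pos' ` s = pos ` s" if "w \<notin> s" for s
    using that unfolding pos'_def by (intro image_cong) auto
  have wt: "w \<notin> t"
    using w t(1) by blast
  have new: "pos' ` insert w s = insert p (pos ` s)" if "s \<subseteq> t" for s
    using old[of s] that wt unfolding pos'_def by auto
  have face: "convex hull (pos ` s) face_of convex hull (pos ` t)" if "s \<subseteq> t" for s
    unfolding face_of_convex_hull_affine_independent[OF ind]
    by (intro exI[of _ "pos ` s"] conjI image_mono that refl)
  \<comment> \<open>A relative interior point lies off the affine hull of every proper face. This
    makes the cones affinely independent and keeps the apex away from the boundary.\<close>
  have notin: "p \<notin> affine hull (pos ` s)" if "s \<subset> t" for s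
  proof -
    have "convex hull (pos ` s) \<noteq> convex hull (pos ` t)"
    proof
      assume eq: "convex hull (pos ` s) = convex hull (pos ` t)"
      have "pos ` t \<inter> convex hull (pos ` s) = pos ` t \<inter> pos ` s"
        using that by (intro affine_independent_Int_convex_hull[OF ind]) auto
      then have "pos ` t \<subseteq> pos ` s"
        using eq hull_subset[of "pos ` t" convex] by blast
      then have "pos ` s = pos ` t"
        using that by blast
      then show False
        using that injt by (simp add: inj_on_image_eq_iff psubset_eq)
    qed
    then have "affine hull (convex hull (pos ` s)) \<inter> rel_interior (convex hull (pos ` t)) = {}"
      using that by (intro affine_hull_face_of_disjoint_rel_interior face) auto
    then show ?thesis
      using p by auto
  qed
  \<comment> \<open>A cone lies inside the old triangle, and an old simplex meets that triangle only
    in the proper face spanned by \<open>f \<inter> t\<close>; on this face the apex drops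
    out.\<close>
  have mixed: "convex hull (insert p (pos ` s)) \<inter> convex hull (pos ` f) \<subseteq> convex hull (pos ` (s \<inter> f))"
    if s: "s \<subset> t" and f: "f \<in> K" "f \<noteq> t" for s f
  proof -
    define r where "r = f \<inter> t"
    have "r \<noteq> t"
    proof
      assume "r = t"
      then have "t \<subseteq> f" unfolding r_def by blast
      then show False
        using K2[OF f(1)] t(2) f(2) by (metis card_seteq)
    qed
    then have r: "r \<subset> t" unfolding r_def by blast
    have sub: "convex hull (insert p (pos ` s)) \<subseteq> convex hull (pos ` t)"
      using pt s by (intro hull_minimal) (auto intro: hull_inc)
    have fin: "finite (insert p (pos ` s))"
      using finite_subset[OF psubset_imp_subset[OF s] ft] by simp
    have "convex hull (insert p (pos ` s)) \<inter> convex hull (pos ` f) \<subseteq>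
          convex hull (insert p (pos ` s)) \<inter> convex hull (pos ` r)"
      using sub K3[OF f(1) t(1)] unfolding r_def by blast
    also have "\<dots> = convex hull (insert p (pos ` s) \<inter> convex hull (pos ` r))"
      using convex_hull_Int_face[OF fin face sub] r by blast
    also have "insert p (pos ` s) \<inter> convex hull (pos ` r) = pos ` s \<inter> convex hull (pos ` r)"
      using notin[OF r] convex_hull_subset_affine_hull by blast
    also have "\<dots> = pos ` s \<inter> pos ` r"
      using r s by (intro affine_independent_Int_convex_hull[OF ind]) auto
    also have "\<dots> = pos ` (s \<inter> r)"
      using injt r s by (metis inj_on_image_Int psubset_imp_subset)
    also have "s \<inter> r = s \<inter> f"
      using s unfolding r_def by blast
    finally show ?thesis .
  qed
  have newnew: "convex hull (insert p (pos ` s)) \<inter> convex hull (insert p (pos ` s')) \<subseteq>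
      convex hull (insert p (pos ` (s \<inter> s')))" if "s \<subset> t" "s' \<subset> t" for s s'
  proof -
    have "pos ` (s \<inter> s') = pos ` s \<inter> pos ` s'"
      using injt that by (metis inj_on_image_Int psubset_imp_subset)
    moreover have "pos ` s \<subseteq> pos ` t" "pos ` s' \<subseteq> pos ` t"
      using that by blast+
    ultimately show ?thesis
      using in_convex_hull_exchange_unique[OF ind pt, of "pos ` s" "pos ` s'"] by auto
  qed
  let ?K = "K - {t} \<union> insert w ` {s. s \<subset> t}"
  have "realizes pos' ?K"
    unfolding realizes_def
  proof (intro conjI ballI)
    fix v assume v: "v \<in> \<Union>?K"
    then consider "v = w" | "v \<in> \<Union>K"
      using t(1) by blast
    then show "{v} \<in> ?K"
    proof cases
      case 1
      then show ?thesis using \<open>t \<noteq> {}\<close> by auto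
    next
      case 2
      then have "{v} \<noteq> t" using t(2) by auto
      then show ?thesis using K1[OF 2] by blast
    qed
  next
    fix s assume s: "s \<in> ?K"
    have "finite s \<and> card s \<le> 3 \<and> \<not> affine_dependent (pos' ` s)"
    proof (cases "w \<in> s")
      case False
      then have "s \<in> K" using s by blast
      then show ?thesis using K2 old[OF False] by simp
    next
      case True
      then obtain r where r: "r \<subset> t" "s = insert w r" using s w by blast
      have "card r < 3" using r ft t(2) psubset_card_mono by metis
      moreover have "finite r" using r ft finite_subset by blast
      moreover have "\<not> affine_dependent (pos ` r)"
        using ind r(1) by (meson affine_dependent_subset image_mono psubset_imp_subset)
      then have "\<not> affine_dependent (insert p (pos ` r))"
        using notin[OF r(1)] affine_independent_insert by blast
      ultimately show ?thesis
        using r new[of r] by (auto simp: card_insert_if)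
    qed
    then show "finite s" "card s \<le> 3" "\<not> affine_dependent (pos' ` s)" by blast+
  next
    fix s s' assume s: "s \<in> ?K" "s' \<in> ?K"
    have cases: "(w \<notin> u \<and> u \<in> K \<and> u \<noteq> t) \<or> (\<exists>r. r \<subset> t \<and> u = insert w r)" if "u \<in> ?K" for u
      using that w by blast
    have mix: "convex hull (pos' ` insert w r) \<inter> convex hull (pos' ` f) \<subseteq>
        convex hull (pos' ` (insert w r \<inter> f))" if "r \<subset> t" "w \<notin> f" "f \<in> K" "f \<noteq> t" for r f
      using mixed[of r f] new[of r] old[of f] old[of "r \<inter> f"] that by (auto simp: psubset_eq)
    show "convex hull (pos' ` s) \<inter> convex hull (pos' ` s') \<subseteq> convex hull (pos' ` (s \<inter> s'))"
    proof (cases "w \<in> s"; cases "w \<in> s'")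
      assume "w \<notin> s" "w \<notin> s'"
      then show ?thesis using cases[OF s(1)] cases[OF s(2)] K3[of s s'] old by (metis IntD1 insertI1)
    next
      assume a: "w \<in> s" "w \<notin> s'"
      then show ?thesis using cases[OF s(1)] cases[OF s(2)] mix by (metis insertI1)
    next
      assume a: "w \<notin> s" "w \<in> s'"
      then show ?thesis using cases[OF s(1)] cases[OF s(2)] mix by (metis inf_commute insertI1)
    next
      assume a: "w \<in> s" "w \<in> s'"
      then obtain r r' where r: "r \<subset> t" "s = insert w r" "r' \<subset> t" "s' = insert w r'"
        using cases[OF s(1)] cases[OF s(2)] by blast
      then have "s \<inter> s' = insert w (r \<inter> r')" by blast
      moreover have "r \<inter> r' \<subseteq> t" using r by blast
      ultimately show ?thesis
        using newnew[OF r(1) r(3)] r by (simp only: new psubset_imp_subset)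
    qed
  qed
  then show ?thesis unfolding pos'_def by blast
qed

lemma realizes_triangle:
  assumes "card t = 3"
  shows "\<exists>pos. realizes pos (Pow t)"
proof -
  have ft: "finite t" using assms by (metis card.infinite zero_neq_numeral)
  \<comment> \<open>The corners form an affine basis of the plane, which has three points because
    the affine dimension is 2.\<close>
  obtain B :: "complex set" where B: "\<not> affine_dependent B" "affine hull UNIV = affine hull B"
    using affine_basis_exists by blast
  have "aff_dim B = 2"
    using B(2) by (metis aff_dim_affine_hull aff_dim_UNIV DIM_complex of_nat_numeral)
  then have "card B = 3" "finite B"
    using B(1) by (auto simp: affine_independent_iff_card)
  then obtain pos where pos: "bij_betw pos t B"
    using finite_same_card_bij ft assms by metis
  have sub: "pos ` s \<subseteq> B" if "s \<subseteq> t" for s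
    using pos that by (auto simp: bij_betw_def)
  have "realizes pos (Pow t)"
    unfolding realizes_def
  proof (intro conjI ballI)
    fix s assume s: "s \<in> Pow t"
    show "finite s" "card s \<le> 3" "\<not> affine_dependent (pos ` s)"
      using s ft assms card_mono finite_subset affine_dependent_subset[of "pos ` s" B] B(1) sub
      by (metis PowD)+
  next
    fix s s' assume s: "s \<in> Pow t" "s' \<in> Pow t"
    have "convex hull (pos ` s') face_of convex hull B"
      using B(1) sub s by (auto simp: face_of_convex_hull_affine_independent)
    then have "convex hull (pos ` s) \<inter> convex hull (pos ` s') =
        convex hull (pos ` s \<inter> convex hull (pos ` s'))"
      using s sub ft by (intro convex_hull_Int_face[where C = "convex hull B"] hull_mono finite_imageI)
        (auto intro: finite_subset)
    also have "pos ` s \<inter> convex hull (pos ` s') = pos ` s \<inter> pos ` s'"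
      using sub s by (intro affine_independent_Int_convex_hull[OF B(1)]) auto
    also have "\<dots> = pos ` (s \<inter> s')"
      using pos s by (metis PowD bij_betw_def inj_on_image_Int)
    finally show "convex hull (pos ` s) \<inter> convex hull (pos ` s') \<subseteq> convex hull (pos ` (s \<inter> s'))"
      by simp
  qed auto
  then show ?thesis by blast
qed

text \<open>Each edge is drawn as the segment between its ends, which is the hull of its image.
  \<open>E\<close> may omit edges of the complex, since the graph sought arises by deleting
  edges.\<close>

lemma realizes_imp_planar:
  assumes K: "realizes pos K" and E: "E \<subseteq> {s \<in> K. card s = 2}"
  shows "planar (\<Union>K) E"
proof -
  have K1: "\<And>v. v \<in> \<Union>K \<Longrightarrow> {v} \<in> K"
    and K3: "\<And>s t. s \<in> K \<Longrightarrow> t \<in> K \<Longrightarrow>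
      convex hull (pos ` s) \<inter> convex hull (pos ` t) \<subseteq> convex hull (pos ` (s \<inter> t))"
    using K unfolding realizes_def by blast+
  have inj: "inj_on pos (\<Union>K)"
    using K by (rule realizes_inj_on)
  have "\<forall>e\<in>E. \<exists>q. fst q \<noteq> snd q \<and> e = {fst q, snd q}"
    using E by (fastforce simp: card_2_iff)
  then obtain q where q: "\<forall>e\<in>E. fst (q e) \<noteq> snd (q e) \<and> e = {fst (q e), snd (q e)}"
    by metis
  define \<gamma> where "\<gamma> e = linepath (pos (fst (q e))) (pos (snd (q e)))" for e
  have \<gamma>: "\<exists>u v. u \<noteq> v \<and> e = {u, v} \<and> \<gamma> e = linepath (pos u) (pos v)" if "e \<in> E" for e
    using q that unfolding \<gamma>_def by blast
  have img: "path_image (\<gamma> e) = convex hull (pos ` e)" if "e \<in> E" for e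
    using \<gamma>[OF that] by (auto simp: segment_convex_hull)
  have vert: "v \<in> e" if "e \<in> E" "v \<in> \<Union>K" "pos v \<in> convex hull (pos ` e)" for e v
  proof -
    have "convex hull (pos ` {v}) \<inter> convex hull (pos ` e) \<subseteq> convex hull (pos ` ({v} \<inter> e))"
      using K3[of "{v}" e] K1 that E by blast
    then have "{v} \<inter> e \<noteq> {}"
      using that(3) by (metis IntI convex_hull_empty empty_iff hull_inc image_empty imageI singletonI subsetD)
    then show ?thesis by blast
  qed
  show ?thesis
    unfolding planar_def
  proof (rule exI[of _ pos], rule exI[of _ \<gamma>], intro conjI ballI impI)
    fix e assume e: "e \<in> E"
    then obtain u v where uv: "u \<noteq> v" "e = {u, v}" "\<gamma> e = linepath (pos u) (pos v)"
      using \<gamma> by blast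
    have eK: "e \<in> K" using e E by blast
    then have "pos u \<noteq> pos v"
      using inj uv by (metis UnionI inj_on_eq_iff insertI1 insert_commute)
    then show "arc (\<gamma> e)" using uv by simp
    show "{pathstart (\<gamma> e), pathfinish (\<gamma> e)} = pos ` e" using uv by simp
    show "path_image (\<gamma> e) \<inter> pos ` \<Union>K = pos ` e"
      unfolding img[OF e] using vert[OF e] eK by (auto intro: hull_inc)
  next
    fix e f assume ef: "e \<in> E" "f \<in> E" "e \<noteq> f"
    \<comment> \<open>Distinct edges share at most one vertex, so the hull of the common vertices
      adds no further points.\<close>
    have "card (e \<inter> f) \<le> 1"
    proof (rule ccontr)
      assume "\<not> card (e \<inter> f) \<le> 1"
      moreover have "card e = 2" "card f = 2" using ef E by blast+
      moreover have "finite e" "finite f" using calculation card.infinite by fastforce+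
      ultimately have "e \<inter> f = e" "e \<inter> f = f"
        by (metis Int_lower1 Int_lower2 card_seteq not_less_eq_eq numeral_2_eq_2 One_nat_def)+
      then show False using ef by blast
    qed
    moreover have "finite (e \<inter> f)" using ef E K unfolding realizes_def by blast
    ultimately have "e \<inter> f = {} \<or> (\<exists>v. e \<inter> f = {v})"
      by (metis One_nat_def card_0_eq card_1_singletonE le_SucE le_zero_eq)
    then have "convex hull (pos ` (e \<inter> f)) = pos ` (e \<inter> f)"
      by (metis convex_hull_empty convex_hull_singleton image_empty image_insert)
    moreover have "path_image (\<gamma> e) \<inter> path_image (\<gamma> f) \<subseteq> convex hull (pos ` (e \<inter> f))"
      using K3[of e f] ef E img by blast
    ultimately show "path_image (\<gamma> e) \<inter> path_image (\<gamma> f) \<subseteq> pos ` (e \<inter> f)" by simp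
  qed (use inj in auto)
qed

section \<open>Local page numbers under insertion of edges\<close>

text \<open>\<open>LEAST\<close> is meaningful only when some \<open>k\<close> qualifies; the
  assumption supplies one.\<close>

lemma local_page_number_attained:
  assumes "\<exists>ord page. k_local_book_embedding k V E ord page"
  shows "\<exists>ord page. k_local_book_embedding (local_page_number V E) V E ord page"
  unfolding local_page_number_def
  by (rule LeastI[of "\<lambda>k. \<exists>ord page. k_local_book_embedding k V E ord page"]) (rule assms)

lemma local_page_number_le:
  assumes "k_local_book_embedding k V E ord page"
  shows "local_page_number V E \<le> k"
  unfolding local_page_number_def using assms by (intro Least_le) blast

text \<open>In \<open>book_embedding\<close> the two edges may coincide, so an edge crossing itself
  could not be given any page.\<close>

lemma not_crossing_self: "\<not> crossing ord e e"
  unfolding crossing_def by (auto simp: doubleton_eq_iff)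

lemma k_local_book_embedding_insert:
  assumes emb: "k_local_book_embedding k V E ord page" and "finite E"
  shows "\<exists>page'. k_local_book_embedding (Suc k) V (insert e E) ord page'"
proof (cases "e \<in> E")
  case True
  then show ?thesis
    using emb unfolding k_local_book_embedding_def
    by (metis insert_absorb le_SucI)
next
  case False
  obtain r where r: "r \<notin> page ` E"
    using ex_new_if_finite[OF infinite_UNIV_nat finite_imageI[OF \<open>finite E\<close>]] by blast
  define page' where "page' = page(e := r)"
  have old: "page' f = page f" if "f \<in> E" for f
    using that False unfolding page'_def by auto
  have new: "page' e = r" unfolding page'_def by simp
  have "page' f \<noteq> page' g" if "f \<in> insert e E" "g \<in> insert e E" "crossing ord f g" for f g
  proof -
    consider "f \<in> E" "g \<in> E" | "f = e" "g \<in> E" | "f \<in> E" "g = e" | "f = e" "g = e"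
      using \<open>f \<in> insert e E\<close> \<open>g \<in> insert e E\<close> by blast
    then show ?thesis
    proof cases
      case 1
      then show ?thesis
        using emb that old unfolding k_local_book_embedding_def book_embedding_def by simp
    next
      case 4
      then show ?thesis using that not_crossing_self by metis
    qed (use r old new in force)+
  qed
  then have "book_embedding V (insert e E) ord page'"
    using emb unfolding k_local_book_embedding_def book_embedding_def by blast
  moreover have "card (pages_at (insert e E) page' v) \<le> Suc k" if "v \<in> V" for v
  proof -
    have "pages_at (insert e E) page' v \<subseteq> insert r (pages_at E page v)"
      using old new unfolding pages_at_def by auto
    moreover have "finite (pages_at E page v)"
      using \<open>finite E\<close> unfolding pages_at_def by simp
    ultimately have "card (pages_at (insert e E) page' v) \<le> card (insert r (pages_at E page v))"
      by (simp add: card_mono)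
    also have "\<dots> \<le> Suc (card (pages_at E page v))"
      using \<open>finite (pages_at E page v)\<close> by (simp add: card_insert_if)
    also have "\<dots> \<le> Suc k"
      using emb that unfolding k_local_book_embedding_def by simp
    finally show ?thesis .
  qed
  ultimately show ?thesis
    unfolding k_local_book_embedding_def by blast
qed

text \<open>Countability of the vertex type supplies the injective rank function.\<close>

lemma k_local_book_embedding_empty:
  fixes V :: "'a::countable set"
  shows "k_local_book_embedding 0 V {} to_nat page"
  unfolding k_local_book_embedding_def book_embedding_def pages_at_def
  by simp

lemma k_local_book_embedding_exists:
  fixes V :: "'a::countable set"
  assumes "finite E"
  shows "\<exists>k ord page. k_local_book_embedding k V E ord page"
  using assms
proof induction
  case empty
  then show ?case using k_local_book_embedding_empty by blast
next
  case (insert e E)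
  then show ?case using k_local_book_embedding_insert by blast
qed

lemma local_page_number_insert_le:
  fixes V :: "'a::countable set"
  assumes "finite E"
  shows "local_page_number V (insert e E) \<le> Suc (local_page_number V E)"
  using local_page_number_attained k_local_book_embedding_exists[OF assms]
    k_local_book_embedding_insert[OF _ assms] local_page_number_le by metis

text \<open>A discrete intermediate value argument: without edges the value is 0, and inserting one
  edge raises it by at most one.\<close>

lemma local_page_number_intermediate:
  fixes V :: "'a::countable set"
  assumes "finite E" "k \<le> local_page_number V E"
  shows "\<exists>F\<subseteq>E. local_page_number V F = k"
  using assms
proof (induction arbitrary: k)
  case empty
  have "local_page_number V {} \<le> 0"
    using local_page_number_le[OF k_local_book_embedding_empty] .
  then show ?case using empty by auto
next
  case (insert e E)
  show ?case
  proof (cases "k \<le> local_page_number V E")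
    case True
    then show ?thesis using insert.IH by blast
  next
    case False
    then have "k = local_page_number V (insert e E)"
      using insert.prems local_page_number_insert_le[OF insert.hyps(1)]
      by (meson Suc_leI le_antisym le_trans not_le)
    then show ?thesis by blast
  qed
qed

section \<open>Obstructions to 2-local book embeddings\<close>

lemma book_embedding_page_neq:
  assumes "book_embedding V E ord page"
    and "{a, c} \<in> E" "{b, d} \<in> E"
    and "ord a < ord b" "ord b < ord c" "ord c < ord d"
  shows "page {a, c} \<noteq> page {b, d}"
proof -
  have "crossing ord {a, c} {b, d}"
    unfolding crossing_def using assms(4-6) by (blast intro: less_trans)
  then show ?thesis
    using assms unfolding book_embedding_def by blast
qed

text \<open>Crossing depends only on the cyclic order, so the vertices of rank below
  \<open>m\<close> may be moved behind all others. This is used to turn the outer of the two arcs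
  between \<open>x\<close> and \<open>y\<close> into an interval.\<close>

lemma book_embedding_rotate:
  assumes emb: "book_embedding V E ord page" and "finite V" "E \<subseteq> Pow V"
  shows "\<exists>ord'. book_embedding V E ord' page \<and>
    (\<forall>u\<in>V. \<forall>v\<in>V. ord' u < ord' v \<longleftrightarrow> (if m \<le> ord u \<longleftrightarrow> m \<le> ord v then ord u < ord v else m \<le> ord u))"
proof -
  obtain N where N: "\<And>v. v \<in> V \<Longrightarrow> ord v < N"
    using finite_nat_bounded[OF finite_imageI[OF \<open>finite V\<close>, of ord]] by auto
  define ord' where "ord' v = (if m \<le> ord v then ord v else ord v + N)" for v
  have less: "ord' u < ord' v \<longleftrightarrow> (if m \<le> ord u \<longleftrightarrow> m \<le> ord v then ord u < ord v else m \<le> ord u)"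
    if "u \<in> V" "v \<in> V" for u v
    using N[OF that(1)] N[OF that(2)] unfolding ord'_def by auto
  have inj: "inj_on ord V"
    using emb unfolding book_embedding_def by blast
  have "inj_on ord' V"
  proof (rule inj_onI)
    fix u v assume "u \<in> V" "v \<in> V" "ord' u = ord' v"
    then have "ord u = ord v"
      using N[of u] N[of v] unfolding ord'_def by (auto split: if_splits)
    then show "u = v"
      using inj \<open>u \<in> V\<close> \<open>v \<in> V\<close> by (simp add: inj_on_eq_iff)
  qed
  moreover have "page e \<noteq> page f" if ef: "e \<in> E" "f \<in> E" and cr: "crossing ord' e f" for e f
  proof -
    have *: "page {a, c} \<noteq> page {b, d}"
      if E: "{a, c} \<in> E" "{b, d} \<in> E" and o: "ord' a < ord' b" "ord' b < ord' c" "ord' c < ord' d"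
      for a b c d
    proof -
      have V: "a \<in> V" "b \<in> V" "c \<in> V" "d \<in> V"
        using E \<open>E \<subseteq> Pow V\<close> by blast+
      have E': "{c, a} \<in> E" "{d, b} \<in> E" using E by (simp_all add: insert_commute)
      \<comment> \<open>Undoing the shift turns an increasing quadruple into one of its four cyclic
        rotations, in which the ends of the two edges still alternate.\<close>
      have "(ord a < ord b \<and> ord b < ord c \<and> ord c < ord d) \<or>
            (ord b < ord c \<and> ord c < ord d \<and> ord d < ord a) \<or>
            (ord c < ord d \<and> ord d < ord a \<and> ord a < ord b) \<or>
            (ord d < ord a \<and> ord a < ord b \<and> ord b < ord c)"
        using o less V by (smt (verit) not_le order_less_le_trans)
      then show ?thesis
        using book_embedding_page_neq[OF emb, of a c b d] book_embedding_page_neq[OF emb, of b d c a]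
          book_embedding_page_neq[OF emb, of c a d b] book_embedding_page_neq[OF emb, of d b a c] E E'
        by (auto simp: insert_commute)
    qed
    obtain u v x y where "e = {u, v}" "f = {x, y}"
      "(ord' u < ord' x \<and> ord' x < ord' v \<and> ord' v < ord' y) \<or>
       (ord' x < ord' u \<and> ord' u < ord' y \<and> ord' y < ord' v)"
      using cr unfolding crossing_def by blast
    then show ?thesis
      using *[of u v x y] *[of x y u v] ef by metis
  qed
  ultimately have "book_embedding V E ord' page"
    unfolding book_embedding_def by blast
  then show ?thesis using less by blast
qed

section \<open>Page sets in a complete graph on four vertices\<close>

lemma K4_pages:
  assumes emb: "k_local_book_embedding 2 V E ord page" and "finite E"
    and Q: "Q \<subseteq> V" "card Q = 4" and cl: "\<And>u v. u \<in> Q \<Longrightarrow> v \<in> Q \<Longrightarrow> u \<noteq> v \<Longrightarrow> {u, v} \<in> E"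
  shows "\<exists>x\<in>Q. \<exists>y\<in>Q. x \<noteq> y \<and>
    (\<exists>p q. pages_at E page x \<subseteq> {p, q} \<and> pages_at E page y \<subseteq> {p, q})"
proof -
  have be: "book_embedding V E ord page"
    and two: "\<And>v. v \<in> V \<Longrightarrow> card (pages_at E page v) \<le> 2"
    using emb unfolding k_local_book_embedding_def by blast+
  have inj: "inj_on ord Q"
    using be Q(1) unfolding book_embedding_def by (meson inj_on_subset)
  have fQ: "finite Q" using Q(2) by (metis card.infinite zero_neq_numeral)
  \<comment> \<open>Sorting the ranks names the four vertices in spine order, so that
    \<open>ac\<close> and \<open>bd\<close> are the crossing pair of edges.\<close>
  define xs where "xs = sorted_list_of_set (ord ` Q)"
  have "length xs = 4"
    using Q(2) inj unfolding xs_def by (simp add: card_image)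
  then obtain i j k l where xs: "xs = [i, j, k, l]"
    by (auto simp: numeral_eq_Suc length_Suc_conv)
  have "set xs = ord ` Q" "sorted_wrt (<) xs"
    using fQ unfolding xs_def by simp_all
  then have "i \<in> ord ` Q" "j \<in> ord ` Q" "k \<in> ord ` Q" "l \<in> ord ` Q" "i < j" "j < k" "k < l"
    using xs by auto
  then obtain a b c d where abcd: "a \<in> Q" "b \<in> Q" "c \<in> Q" "d \<in> Q"
      "ord a < ord b" "ord b < ord c" "ord c < ord d"
    by blast
  then have ne: "a \<noteq> b" "a \<noteq> c" "a \<noteq> d" "b \<noteq> c" "b \<noteq> d" "c \<noteq> d" by auto
  \<comment> \<open>If any two of the four page sets shared only one page, all of them would share the same one,
    which would then carry the crossing edges \<open>ac\<close> and \<open>bd\<close>.\<close>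
  have cross: "page {a, c} \<noteq> page {b, d}"
    using abcd ne cl by (intro book_embedding_page_neq[OF be]) auto
  have edge: "page {u, v} \<in> pages_at E page u" "page {u, v} \<in> pages_at E page v"
    if "u \<in> Q" "v \<in> Q" "u \<noteq> v" for u v
    using cl[OF that] unfolding pages_at_def by auto
  have cover: "pages_at E page v \<subseteq> {p, q}"
    if "v \<in> Q" "p \<in> pages_at E page v" "q \<in> pages_at E page v" "p \<noteq> q" for v p q
  proof -
    have "finite (pages_at E page v)"
      using \<open>finite E\<close> unfolding pages_at_def by simp
    moreover have "card (pages_at E page v) \<le> card {p, q}"
      using two[of v] that Q(1) by auto
    ultimately show ?thesis
      using that card_seteq[of "pages_at E page v" "{p, q}"] by blast
  qed
  let ?P = "pages_at E page"
  show ?thesis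
  proof (rule ccontr)
    assume "\<not> ?thesis"
    \<comment> \<open>Two distinct pages shared by \<open>x\<close> and \<open>y\<close> would by
      \<open>cover\<close> be all the pages of both, which is the denied conclusion.\<close>
    then have no: "p = q" if "x \<in> Q" "y \<in> Q" "x \<noteq> y" "p \<in> ?P x" "q \<in> ?P x" "p \<in> ?P y" "q \<in> ?P y"
      for x y p q
      using that cover by metis
    have mem: "page {a, b} \<in> ?P a" "page {a, b} \<in> ?P b" "page {a, c} \<in> ?P a" "page {a, c} \<in> ?P c"
      "page {a, d} \<in> ?P a" "page {a, d} \<in> ?P d" "page {b, c} \<in> ?P b" "page {b, c} \<in> ?P c"
      "page {b, d} \<in> ?P b" "page {b, d} \<in> ?P d" "page {c, d} \<in> ?P c" "page {c, d} \<in> ?P d"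
      using edge abcd ne by blast+
    have three: "r = p \<or> r = q"
      if "v \<in> Q" "p \<in> ?P v" "q \<in> ?P v" "r \<in> ?P v" "p \<noteq> q" for v p q r
      using cover[of v p q] that by blast
    \<comment> \<open>If \<open>v\<close> used the page of \<open>ac\<close>, no other vertex could
      use both diagonal pages. Then the edges from \<open>v'\<close> to \<open>a\<close> and
      \<open>c\<close> share a page, which \<open>a\<close> and \<open>c\<close> have in common
      besides that of \<open>ac\<close>; it must equal the latter, although \<open>v'\<close> avoids
      it.\<close>
    have step: False
      if v: "v \<in> {b, d}" "v' \<in> {b, d}" "v \<noteq> v'" "page {a, c} \<in> ?P v" for v v'
    proof -
      have vQ: "v \<in> Q" "v' \<in> Q" "v \<noteq> a" "v \<noteq> c" "v' \<noteq> a" "v' \<noteq> c" "v \<noteq> v'"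
        using v abcd ne by auto
      have t: "page {b, d} \<in> ?P v" "page {b, d} \<in> ?P v'"
        using mem v by auto
      have out: "page {b, d} \<notin> ?P a" "page {b, d} \<notin> ?P c" "page {a, c} \<notin> ?P v'"
        using no[of a v] no[of c v] no[of v' v] vQ abcd t mem v(4) cross by metis+
      have m: "page {a, v'} \<in> ?P a" "page {a, v'} \<in> ?P v'" "page {c, v'} \<in> ?P c" "page {c, v'} \<in> ?P v'"
        using edge abcd vQ by metis+
      then have "page {c, v'} = page {a, v'}"
        using three[of v'] vQ t out by metis
      then show False
        using no[of a c] abcd ne mem m out by metis
    qed
    have out: "page {a, c} \<notin> ?P b" "page {a, c} \<notin> ?P d"
      using step ne by blast+
    \<comment> \<open>The edges from \<open>u\<close> to \<open>b\<close> and \<open>d\<close> avoid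
      the page of \<open>ac\<close>, so they share one page. As \<open>b\<close> and
      \<open>d\<close> also have the page of \<open>bd\<close> in common, it is that page.\<close>
    have t: "page {b, d} \<in> ?P u" if "u \<in> {a, c}" for u
    proof -
      have uQ: "u \<in> Q" "u \<noteq> b" "u \<noteq> d" "page {a, c} \<in> ?P u"
        using that abcd ne mem by auto
      have m: "page {u, b} \<in> ?P u" "page {u, b} \<in> ?P b" "page {u, d} \<in> ?P u" "page {u, d} \<in> ?P d"
        using edge abcd uQ by metis+
      then have "page {u, d} = page {u, b}"
        using three[of u] uQ out by metis
      then have "page {u, b} = page {b, d}"
        using no[of b d] abcd ne m mem by metis
      then show ?thesis using m by simp
    qed
    then show False
      using no[of a c] abcd ne mem cross by blast
  qed
qed

section \<open>Blocks of common neighbours of two vertices on the same two pages\<close>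

text \<open>Here \<open>f\<close> plays the role of the edge \<open>uv\<close> with its witnesses
  \<open>d\<close> and \<open>e\<close>. The conditions \<open>d \<noteq> y\<close> and
  \<open>e \<noteq> x\<close> matter because, when \<open>xy\<close> is an edge, \<open>y\<close>
  and \<open>x\<close> would be trivial witnesses.\<close>

definition block :: "'a set set \<Rightarrow> 'a \<Rightarrow> 'a \<Rightarrow> 'a set \<Rightarrow> bool" where
  "block E x y f \<longleftrightarrow> f \<in> E \<and> x \<notin> f \<and> y \<notin> f \<and> (\<forall>a\<in>f. {x, a} \<in> E \<and> {y, a} \<in> E) \<and>
     (\<exists>d. d \<noteq> y \<and> {x, d} \<in> E \<and> (\<forall>a\<in>f. {a, d} \<in> E)) \<and>
     (\<exists>e. e \<noteq> x \<and> {y, e} \<in> E \<and> (\<forall>a\<in>f. {a, e} \<in> E))"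

lemma block_mono: "block E x y f \<Longrightarrow> E \<subseteq> E' \<Longrightarrow> block E' x y f"
  unfolding block_def by blast

lemma block_sym: "block E x y f \<longleftrightarrow> block E y x f"
  unfolding block_def by blast

text \<open>Two members of \<open>A\<close> are required on each side: the outermost one determines
  the pages, and the next one acts as a fence.\<close>

definition deep :: "('a \<Rightarrow> nat) \<Rightarrow> 'a set \<Rightarrow> 'a \<Rightarrow> bool" where
  "deep ord A u \<longleftrightarrow> (\<exists>a\<in>A. \<exists>b\<in>A. ord a < ord b \<and> ord b < ord u) \<and>
     (\<exists>a\<in>A. \<exists>b\<in>A. ord u < ord b \<and> ord b < ord a)"

text \<open>Each side fails for at most two vertices, because the last of three failing vertices
  would have the other two beyond it.\<close>

lemma card_not_deep:
  assumes "finite A" "inj_on ord A"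
  shows "card {u \<in> A. \<not> deep ord A u} \<le> 4"
proof -
  have three: "\<exists>a\<in>S. \<exists>b\<in>S. \<exists>c\<in>S. ord a < ord b \<and> ord b < ord c" if "S \<subseteq> A" "2 < card S" for S
  proof -
    have "card (ord ` S) > 2"
      using that assms by (metis card_image inj_on_subset)
    then obtain T where T: "T \<subseteq> ord ` S" "card T = 3" "finite T"
      using obtain_subset_with_card_n[of 3 "ord ` S"] by auto
    have "length (sorted_list_of_set T) = 3"
      using T(2) by simp
    then obtain i j k where ijk: "sorted_list_of_set T = [i, j, k]"
      by (auto simp only: numeral_3_eq_3 length_Suc_conv length_0_conv)
    then have "T = {i, j, k}" "i < j" "j < k"
      using set_sorted_list_of_set[OF T(3)] strict_sorted_list_of_set[of T] by auto
    then show ?thesis using T(1) by auto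
  qed
  let ?L = "{u \<in> A. \<not> (\<exists>a\<in>A. \<exists>b\<in>A. ord a < ord b \<and> ord b < ord u)}"
  let ?R = "{u \<in> A. \<not> (\<exists>a\<in>A. \<exists>b\<in>A. ord u < ord b \<and> ord b < ord a)}"
  have "card ?L \<le> 2"
  proof (rule ccontr)
    assume "\<not> card ?L \<le> 2"
    then have "2 < card ?L" by simp
    moreover have "?L \<subseteq> A" by blast
    ultimately obtain a b c where "a \<in> ?L" "b \<in> ?L" "c \<in> ?L" "ord a < ord b" "ord b < ord c"
      using three by meson
    then show False by blast
  qed
  moreover have "card ?R \<le> 2"
  proof (rule ccontr)
    assume "\<not> card ?R \<le> 2"
    then have "2 < card ?R" by simp
    moreover have "?R \<subseteq> A" by blast
    ultimately obtain a b c where "a \<in> ?R" "b \<in> ?R" "c \<in> ?R" "ord a < ord b" "ord b < ord c"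
      using three by meson
    then show False by blast
  qed
  moreover have "{u \<in> A. \<not> deep ord A u} = ?L \<union> ?R"
    unfolding deep_def by blast
  moreover have "card (?L \<union> ?R) \<le> card ?L + card ?R"
    by (rule card_Un_le)
  ultimately show ?thesis by simp
qed

text \<open>The fencing argument for one arc \<open>A\<close>. The vertex \<open>v\<close> is only
  assumed to be in \<open>C\<close>; that it lies in the same arc as \<open>u\<close> is forced by
  the fences around \<open>u\<close>.\<close>

lemma deep_block_impossible:
  assumes emb: "book_embedding V E ord page"
    and two: "\<And>v. v \<in> V \<Longrightarrow> card (pages_at E page v) \<le> 2"
    and E: "finite E" "E \<subseteq> Pow V" "\<And>e. e \<in> E \<Longrightarrow> card e = 2"
    and px: "pages_at E page x \<subseteq> {p, q}" and py: "pages_at E page y \<subseteq> {p, q}"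
    and xy: "ord x < ord y" "x \<in> V" "y \<in> V"
    and C: "finite C" "\<And>c. c \<in> C \<Longrightarrow> {x, c} \<in> E \<and> {y, c} \<in> E"
    and A: "A = {c \<in> C. ord x < ord c \<and> ord c < ord y}"
    and blk: "block E x y {u, v}"
    and uv: "u \<in> A" "v \<in> C" "deep ord A u" "v \<in> A \<Longrightarrow> deep ord A v"
  shows False
proof -
  have inj: "inj_on ord V" using emb unfolding book_embedding_def by blast
  have E2: "a \<in> V" "b \<in> V" "a \<noteq> b" "ord a \<noteq> ord b" if "{a, b} \<in> E" for a b
  proof -
    show "a \<in> V" "b \<in> V" using that E(2) by blast+
    show "a \<noteq> b" using E(3)[OF that] by auto
    then show "ord a \<noteq> ord b" using \<open>a \<in> V\<close> \<open>b \<in> V\<close> inj by (simp add: inj_on_eq_iff)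
  qed
  have neq: "page {a, c} \<noteq> page {b, d}"
    if "{a, c} \<in> E" "{b, d} \<in> E" "ord a < ord b" "ord b < ord c" "ord c < ord d" for a b c d
    using book_embedding_page_neq[OF emb] that by blast
  have pg: "page {a, b} \<in> pages_at E page a" "page {a, b} \<in> pages_at E page b" if "{a, b} \<in> E" for a b
    using that unfolding pages_at_def by auto
  have xpg: "page {x, c} = p \<or> page {x, c} = q" if "{x, c} \<in> E" for c
    using pg[OF that] px by blast
  have ypg: "page {y, c} = p \<or> page {y, c} = q" if "{y, c} \<in> E" for c
    using pg[OF that] py by blast
  have Ax: "{x, c} \<in> E" "{y, c} \<in> E" "{c, y} \<in> E" "{c, x} \<in> E" "ord x < ord c" "ord c < ord y" "c \<in> V"
    if "c \<in> A" for c
    using that A C(2)[of c] E2[of x c] by (auto simp: insert_commute)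
  have fA: "finite A" using A C(1) by simp
  have neA: "A \<noteq> {}" using uv by blast
  obtain l where l: "l \<in> A" "\<And>a. a \<in> A \<Longrightarrow> ord l \<le> ord a"
    using ex_is_arg_min_if_finite[OF fA neA, of ord] by (auto simp: is_arg_min_linorder)
  have "Max (ord ` A) \<in> ord ` A"
    using fA neA by (intro Max_in) auto
  then obtain r where "r \<in> A" "ord r = Max (ord ` A)"
    by auto
  then have r: "r \<in> A" "\<And>a. a \<in> A \<Longrightarrow> ord a \<le> ord r"
    using fA by simp_all
  \<comment> \<open>In the order \<open>x, a, b, y\<close> the edges \<open>xb\<close> and
    \<open>ay\<close> cross.\<close>
  have first: "page {x, b} \<noteq> page {y, a}" if "a \<in> A" "b \<in> A" "ord a < ord b" for a b
    using neq[of x b a y] Ax[OF that(1)] Ax[OF that(2)] that(3) by (simp add: insert_commute)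
  \<comment> \<open>The extreme members \<open>l\<close> and \<open>r\<close> fix the roles of the
    two pages: edges to \<open>y\<close> use \<open>s\<close> before \<open>r\<close>, and edges to
    \<open>x\<close> use \<open>s'\<close> after \<open>l\<close>.\<close>
  define s where "s = page {y, l}"
  define s' where "s' = page {x, r}"
  have lr: "ord l < ord r"
    using uv(3) l r unfolding deep_def by (meson le_less_trans less_le_trans)
  have ss: "s \<noteq> s'"
    using first[OF l(1) r(1) lr] unfolding s_def s'_def by simp
  have ssp: "s = p \<or> s = q" "s' = p \<or> s' = q"
    unfolding s_def s'_def using xpg ypg Ax l r by blast+
  have sx: "page {x, a} = s'" if "a \<in> A" "ord l < ord a" for a
    using first[OF l(1) that] xpg[of a] Ax[OF that(1)] ss ssp unfolding s_def by metis
  have sy: "page {y, a} = s" if "a \<in> A" "ord a < ord r" for a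
    using first[OF that(1) r(1) that(2)] ypg[of a] Ax[OF that(1)] ss ssp unfolding s'_def by metis
  \<comment> \<open>Strictly between \<open>l\<close> and \<open>r\<close> the edges to
    \<open>x\<close> and \<open>y\<close> already exhaust the two pages allowed at
    \<open>a\<close>.\<close>
  have cover: "page {a, b} = s \<or> page {a, b} = s'"
    if "a \<in> A" "ord l < ord a" "ord a < ord r" "{a, b} \<in> E" for a b
  proof -
    have fin: "finite (pages_at E page a)" using E(1) unfolding pages_at_def by simp
    have sub: "{s, s'} \<subseteq> pages_at E page a"
      using sx[OF that(1,2)] sy[OF that(1,3)] pg[of x a] pg[of y a] Ax[OF that(1)] by auto
    have "card (pages_at E page a) \<le> card {s, s'}"
      using two[of a] Ax[OF that(1)] ss by simp
    then have "{s, s'} = pages_at E page a"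
      using card_seteq[OF fin sub] by blast
    then show ?thesis using pg[OF that(4)] by blast
  qed
  \<comment> \<open>An edge from \<open>c\<close> past one of the fences \<open>a\<close>,
    \<open>b\<close> crosses an edge at \<open>x\<close> on page \<open>s'\<close> and an edge at
    \<open>y\<close> on page \<open>s\<close>, in each of the four possible positions of
    \<open>d\<close>.\<close>
  have trap: "ord a \<le> ord d \<and> ord d \<le> ord b"
    if abc: "a \<in> A" "b \<in> A" "c \<in> A" "ord l < ord a" "ord a < ord c" "ord c < ord b" "ord b < ord r"
      and d: "{c, d} \<in> E" "d \<noteq> x" "d \<noteq> y" for a b c d
  proof (rule ccontr)
    assume con: "\<not> ?thesis"
    have dV: "d \<in> V" "ord d \<noteq> ord x" "ord d \<noteq> ord y"
      using E2[OF d(1)] d xy inj by (auto simp: inj_on_eq_iff)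
    have dE: "{d, c} \<in> E" using d(1) by (simp add: insert_commute)
    have cd: "page {c, d} = s \<or> page {c, d} = s'"
      using cover[of c d] abc d(1) by linarith
    have ab: "page {x, a} = s'" "page {y, a} = s" "page {x, b} = s'" "page {y, b} = s"
      using sx sy abc by auto
    consider "ord d < ord x" | "ord x < ord d" "ord d < ord a" | "ord b < ord d" "ord d < ord y" | "ord y < ord d"
      using con dV by linarith
    then show False
    proof cases
      case 1
      then show False
        using neq[of d c x b] neq[of d c a y] dE Ax[OF abc(1)] Ax[OF abc(2)] abc ab cd by (simp add: insert_commute)
    next
      case 2
      then show False
        using neq[of x a d c] neq[of d c a y] dE Ax[OF abc(1)] Ax[OF abc(2)] abc ab cd by (simp add: insert_commute)
    next
      case 3
      then show False
        using neq[of x b c d] neq[of c d b y] d Ax[OF abc(1)] Ax[OF abc(2)] abc ab cd by (simp add: insert_commute)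
    next
      case 4
      then show False
        using neq[of x b c d] neq[of a y c d] d Ax[OF abc(1)] Ax[OF abc(2)] Ax[OF abc(3)] abc ab cd by (simp add: insert_commute)
    qed
  qed
  have deepD: "\<exists>a\<in>A. \<exists>b\<in>A. ord l < ord a \<and> ord a < ord w \<and> ord w < ord b \<and> ord b < ord r" if "deep ord A w" for w
    using that l(2) r(2) unfolding deep_def by (meson le_less_trans less_le_trans)
  have uvE: "{u, v} \<in> E" "u \<noteq> x" "u \<noteq> y" "v \<noteq> x" "v \<noteq> y"
    using blk unfolding block_def by auto
  have vA: "v \<in> A"
  proof -
    obtain a b where ab: "a \<in> A" "b \<in> A" "ord l < ord a" "ord a < ord u" "ord u < ord b" "ord b < ord r"
      using deepD[OF uv(3)] by blast
    then have "ord a \<le> ord v" "ord v \<le> ord b"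
      using trap[of a b u v] uv(1) uvE by blast+
    then show ?thesis
      using Ax[OF ab(1)] Ax[OF ab(2)] uv(2) unfolding A by auto
  qed
  have final: False
    if uv: "u \<in> A" "v \<in> A" "deep ord A u" "deep ord A v" and less: "ord u < ord v"
      and blk: "block E x y {u, v}" for u v
  proof -
    obtain d e where d: "d \<noteq> y" "{x, d} \<in> E" "{u, d} \<in> E" "{v, d} \<in> E"
      and e: "e \<noteq> x" "{y, e} \<in> E" "{u, e} \<in> E" "{v, e} \<in> E"
      using blk unfolding block_def by auto
    have uvE: "{u, v} \<in> E" using blk unfolding block_def by blast
    obtain a where a: "a \<in> A" "ord l < ord a" "ord a < ord u"
      using deepD[OF uv(3)] by blast
    obtain b where b: "b \<in> A" "ord v < ord b" "ord b < ord r"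
      using deepD[OF uv(4)] by blast
    \<comment> \<open>Now \<open>v\<close> is the right fence for neighbours of \<open>u\<close>,
      and \<open>u\<close> the left fence for neighbours of \<open>v\<close>.\<close>
    have between: "ord u < ord w \<and> ord w < ord v" if "w \<noteq> x" "w \<noteq> y" "{u, w} \<in> E" "{v, w} \<in> E" for w
    proof -
      have "ord w \<le> ord v" using trap[of a v u w] a b uv less that by simp
      moreover have "ord u \<le> ord w" using trap[of u b v w] a b uv less that by simp
      ultimately show ?thesis using E2(4)[OF that(3)] E2(4)[OF that(4)] by simp
    qed
    have d': "ord u < ord d" "ord d < ord v" "{d, x} \<in> E"
      using between[of d] d E2(3)[OF d(2)] by (auto simp: insert_commute)
    have e': "ord u < ord e" "ord e < ord v" "{e, y} \<in> E"
      using between[of e] e E2(3)[OF e(2)] by (auto simp: insert_commute)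
    have pu: "page {x, u} = s'" "page {y, u} = s" "page {x, v} = s'" "page {y, v} = s"
      using sx sy uv a b less by auto
    \<comment> \<open>Crossing \<open>uy\<close> puts \<open>xd\<close> on \<open>s'\<close>, and
      crossing \<open>xv\<close> puts \<open>ye\<close> on \<open>s\<close>. Since \<open>uv\<close>
      crosses both \<open>xd\<close> and \<open>ye\<close>, no page remains for it.\<close>
    have "page {x, d} \<noteq> s"
      using neq[of x d u y] d d' Ax[OF uv(1)] Ax[OF uv(2)] pu by (simp add: insert_commute)
    then have "page {x, d} = s'"
      using xpg[OF d(2)] ss ssp by metis
    then have 1: "page {u, v} \<noteq> s'"
      using neq[of x d u v] d d' Ax[OF uv(1)] uvE by simp
    have "page {y, e} \<noteq> s'"
      using neq[of x v e y] e' Ax[OF uv(1)] Ax[OF uv(2)] pu by (simp add: insert_commute)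
    then have "page {y, e} = s"
      using ypg[OF e(2)] ss ssp by metis
    then have 2: "page {u, v} \<noteq> s"
      using neq[of u v e y] e' Ax[OF uv(2)] uvE by (simp add: insert_commute)
    show False
      using cover[of u v] uv a b less uvE 1 2 by simp
  qed
  show False
    using final[OF uv(1) vA uv(3) uv(4)[OF vA]] final[OF vA uv(1) uv(4)[OF vA] uv(3)] blk E2(4)[OF uvE(1)]
    by (metis insert_commute nat_neq_iff)
qed

text \<open>The vertices \<open>x\<close> and \<open>y\<close> split the cyclic order into two arcs.
  Each arc has at most four vertices that are not deep, and 9 exceeds 4 + 4.\<close>

lemma blocks_impossible:
  assumes emb: "k_local_book_embedding 2 V E ord page"
    and G: "simple_graph V E"
    and px: "pages_at E page x \<subseteq> {p, q}" and py: "pages_at E page y \<subseteq> {p, q}"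
    and xy: "x \<noteq> y" "x \<in> V" "y \<in> V"
    and P: "card P = 9" "disjoint P" "\<And>f. f \<in> P \<Longrightarrow> block E x y f"
  shows False
proof -
  have be: "book_embedding V E ord page"
    and two: "\<And>v. v \<in> V \<Longrightarrow> card (pages_at E page v) \<le> 2"
    using emb unfolding k_local_book_embedding_def by blast+
  have inj: "inj_on ord V" using be unfolding book_embedding_def by blast
  have fV: "finite V" and EV: "E \<subseteq> Pow V" and E2: "\<And>e. e \<in> E \<Longrightarrow> card e = 2"
    using G unfolding simple_graph_def by blast+
  have fE: "finite E" using EV fV by (meson finite_Pow_iff finite_subset)
  have main: False
    if xy: "ord x < ord y" "x \<in> V" "y \<in> V"
      and px: "pages_at E page x \<subseteq> {p, q}" and py: "pages_at E page y \<subseteq> {p, q}"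
      and P: "\<And>f. f \<in> P \<Longrightarrow> block E x y f" for x y
  proof -
    define C where "C = \<Union>P"
    have PE: "P \<subseteq> E" using P unfolding block_def by blast
    have CV: "C \<subseteq> V" using PE EV unfolding C_def by blast
    have fC: "finite C" using CV fV finite_subset by blast
    have CE: "{x, c} \<in> E \<and> {y, c} \<in> E" if "c \<in> C" for c
      using that P unfolding C_def block_def by blast
    have CE': "{y, c} \<in> E \<and> {x, c} \<in> E" if "c \<in> C" for c
      using CE[OF that] by blast
    have Cxy: "c \<noteq> x" "c \<noteq> y" "ord c \<noteq> ord x" "ord c \<noteq> ord y" if "c \<in> C" for c
    proof -
      show "c \<noteq> x" "c \<noteq> y" using that P unfolding C_def block_def by blast+
      then show "ord c \<noteq> ord x" "ord c \<noteq> ord y"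
        using inj xy CV that by (auto simp: inj_on_eq_iff)
    qed
    \<comment> \<open>Starting the order at \<open>y\<close> places everything outside the interval
      from \<open>x\<close> to \<open>y\<close> between \<open>y\<close> and
      \<open>x\<close>.\<close>
    obtain ord' where be': "book_embedding V E ord' page"
      and ord': "\<And>u v. u \<in> V \<Longrightarrow> v \<in> V \<Longrightarrow> ord' u < ord' v \<longleftrightarrow>
        (if ord y \<le> ord u \<longleftrightarrow> ord y \<le> ord v then ord u < ord v else ord y \<le> ord u)"
      using book_embedding_rotate[OF be fV EV, of "ord y"] by blast
    define A where "A = {c \<in> C. ord x < ord c \<and> ord c < ord y}"
    define B where "B = {c \<in> C. ord' y < ord' c \<and> ord' c < ord' x}"
    have AB: "c \<in> A \<or> c \<in> B" if "c \<in> C" for c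
    proof -
      have "c \<in> V" using that CV by blast
      then show ?thesis
        using that xy Cxy[OF that] ord'[of y c] ord'[of c x] unfolding A_def B_def by auto
    qed
    have yx: "ord' y < ord' x" using ord'[of y x] xy by simp
    \<comment> \<open>At most four vertices of each arc are not deep, so one of the nine blocks avoids them all.\<close>
    define bad where "bad = {u \<in> A. \<not> deep ord A u} \<union> {u \<in> B. \<not> deep ord' B u}"
    have fAB: "finite A" "finite B" "A \<subseteq> V" "B \<subseteq> V"
      using fC CV unfolding A_def B_def by auto
    have inj': "inj_on ord' V" using be' unfolding book_embedding_def by blast
    have "card bad \<le> card {u \<in> A. \<not> deep ord A u} + card {u \<in> B. \<not> deep ord' B u}"
      unfolding bad_def by (rule card_Un_le)
    also have "\<dots> \<le> 4 + 4"
      using fAB inj inj' by (intro add_mono card_not_deep) (auto intro: inj_on_subset)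
    finally have "card bad < card P" using assms(8) by simp
    moreover have "finite bad" unfolding bad_def using fAB by simp
    have "\<exists>f\<in>P. f \<inter> bad = {}"
    proof (rule ccontr)
      assume "\<not> ?thesis"
      then have "\<forall>f\<in>P. \<exists>w. w \<in> f \<inter> bad" by blast
      then obtain g where g: "\<forall>f\<in>P. g f \<in> f \<inter> bad" by (rule bchoice[THEN exE])
      have "inj_on g P"
        using g assms(9) unfolding disjoint_def by (intro inj_onI) (metis IntE IntI empty_iff)
      then have "card P \<le> card bad"
        using g \<open>finite bad\<close> by (metis IntE card_inj_on_le image_subsetI)
      then show False using \<open>card bad < card P\<close> by simp
    qed
    then obtain f where f: "f \<in> P" "f \<inter> bad = {}" by blast
    then obtain u v where fuv: "f = {u, v}" using E2 PE by (metis card_2_iff subsetD)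
    have blk: "block E x y {u, v}" "block E y x {u, v}" using P f fuv block_sym by metis+
    have uC: "u \<in> C" "v \<in> C" using f fuv unfolding C_def by auto
    have nb: "u \<notin> bad" "v \<notin> bad" using f fuv by auto
    from AB[OF uC(1)] show False
    proof
      assume "u \<in> A"
      then show False
        using deep_block_impossible[OF be two fE EV E2 px py xy fC CE A_def blk(1) _ uC(2)] nb
        unfolding bad_def by blast
    next
      assume "u \<in> B"
      then show False
        using deep_block_impossible[OF be' two fE EV E2 py px yx xy(3,2) fC CE' B_def blk(2) _ uC(2)] nb
        unfolding bad_def by blast
    qed
  qed
  have "ord x \<noteq> ord y" using xy inj by (simp add: inj_on_eq_iff)
  then consider "ord x < ord y" | "ord y < ord x" by linarith
  then show False
  proof cases
    case 1
    then show False using main[of x y] xy px py P by blast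
  next
    case 2
    then show False using main[of y x] xy px py P block_sym by metis
  qed
qed

section \<open>A stacked triangulation without a 2-local book embedding\<close>

text \<open>The edge graphs are the Apollonian networks. The triples in \<open>K\<close> are the
  bounded faces still available for stacking; a subdivided triangle is dropped.\<close>

inductive stacked :: "nat set set \<Rightarrow> bool" where
  triangle: "stacked (Pow {0, 1, 2})"
| stack: "stacked K \<Longrightarrow> t \<in> K \<Longrightarrow> card t = 3 \<Longrightarrow> w \<notin> \<Union>K \<Longrightarrow>
    stacked (K - {t} \<union> insert w ` {s. s \<subset> t})"

lemma stacked_realizable: "stacked K \<Longrightarrow> finite (\<Union>K) \<and> (\<exists>pos. realizes pos K)"
proof (induction rule: stacked.induct)
  case triangle
  then show ?case using realizes_triangle[of "{0, 1, 2 :: nat}"] by simp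
next
  case (stack K t w)
  have "\<Union>(K - {t} \<union> insert w ` {s. s \<subset> t}) \<subseteq> insert w (\<Union>K)"
    using stack.hyps(2) by blast
  then have "finite (\<Union>(K - {t} \<union> insert w ` {s. s \<subset> t}))"
    using stack.IH finite_subset by blast
  moreover have "\<exists>pos. realizes pos (K - {t} \<union> insert w ` {s. s \<subset> t})"
    using stack.IH realizes_stack[OF _ stack.hyps(2-4)] by blast
  ultimately show ?case by blast
qed

abbreviation edges :: "'a set set \<Rightarrow> 'a set set" where
  "edges K \<equiv> {s \<in> K. card s = 2}"

lemma edges_mono_Diff: "card t = 3 \<Longrightarrow> K - {t} \<subseteq> K' \<Longrightarrow> edges K \<subseteq> edges K'"
  by auto

text \<open>Collects the effect of one stacking step: only the subdivided triangle is lost, and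
  three new triangles become available.\<close>

lemma obtain_stack:
  assumes K: "stacked K" "{x, y, z} \<in> K" and xyz: "x \<noteq> y" "y \<noteq> z" "x \<noteq> z"
  obtains w K' where "stacked K'" "w \<notin> \<Union>K" "w \<in> \<Union>K'" "\<Union>K \<subseteq> \<Union>K'" "K - {{x, y, z}} \<subseteq> K'"
    "{w, x} \<in> edges K'" "{w, y} \<in> edges K'" "{w, z} \<in> edges K'"
    "{w, x, y} \<in> K'" "{w, y, z} \<in> K'" "{w, x, z} \<in> K'"
    "edges K \<subseteq> edges K'"
proof -
  have "finite (\<Union>K)" using stacked_realizable[OF K(1)] by blast
  then obtain w where w: "w \<notin> \<Union>K" using ex_new_if_finite[OF infinite_UNIV_nat] by blast
  let ?t = "{x, y, z}"
  let ?K = "K - {?t} \<union> insert w ` {s. s \<subset> ?t}"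
  have c: "card ?t = 3" using xyz by simp
  have st: "stacked ?K" using stacked.stack[OF K c w] .
  have new: "insert w s \<in> ?K" if "s \<subset> ?t" for s using that by blast
  have wt: "w \<noteq> x" "w \<noteq> y" "w \<noteq> z" using w K(2) by blast+
  have e: "{w, x} \<in> edges ?K" "{w, y} \<in> edges ?K" "{w, z} \<in> edges ?K"
    using new[of "{x}"] new[of "{y}"] new[of "{z}"] xyz wt by auto
  have p: "{x, y} \<subset> ?t" "{y, z} \<subset> ?t" "{x, z} \<subset> ?t"
    using xyz by (auto simp: psubset_eq set_eq_iff)
  have tr: "{w, x, y} \<in> ?K" "{w, y, z} \<in> ?K" "{w, x, z} \<in> ?K"
    by (rule new[OF p(1)] new[OF p(2)] new[OF p(3)])+
  have un: "\<Union>K \<subseteq> \<Union>?K"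
  proof
    fix v assume "v \<in> \<Union>K"
    then obtain s where s: "s \<in> K" "v \<in> s" by blast
    show "v \<in> \<Union>?K"
    proof (cases "s = ?t")
      case True
      then have "v \<in> {w, x, y} \<union> {w, y, z}" using s(2) by blast
      then show ?thesis using tr(1,2) by (meson UnE UnionI)
    next
      case False
      then have "s \<in> ?K" using s(1) by simp
      then show ?thesis using s(2) by (rule UnionI)
    qed
  qed
  have keep: "K - {?t} \<subseteq> ?K" by blast
  have wK: "w \<in> \<Union>?K" by (rule UnionI[OF tr(1)]) simp
  show ?thesis
    by (rule that[OF st w wK un keep e tr edges_mono_Diff[OF c keep]])
qed

section \<open>Filling triangular faces with blocks\<close>

text \<open>Stack \<open>c\<close> into \<open>xyz\<close>, \<open>c'\<close> into
  \<open>cxy\<close>, \<open>d\<close> into \<open>c'cx\<close> and \<open>e\<close> into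
  \<open>c'cy\<close>. The untouched face \<open>xyc'\<close> allows repetition for the pair
  \<open>x, y\<close>, and \<open>xzc\<close> stays free for the pair \<open>x, z\<close>.\<close>

lemma add_block:
  assumes K: "stacked K" "{x, y, z} \<in> K" and xyz: "x \<noteq> y" "y \<noteq> z" "x \<noteq> z"
  obtains K' c c' where "stacked K'" "K - {{x, y, z}} \<subseteq> K'" "edges K \<subseteq> edges K'"
    "\<Union>K \<subseteq> \<Union>K'" "c \<in> \<Union>K'" "c' \<in> \<Union>K'" "c \<notin> \<Union>K" "c' \<notin> \<Union>K" "c \<noteq> c'"
    "block (edges K') x y {c, c'}" "{x, y, c'} \<in> K'" "{x, z, c} \<in> K'"
proof -
  have xyzK: "x \<in> \<Union>K" "y \<in> \<Union>K" "z \<in> \<Union>K" using K(2) by blast+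
  obtain c K1 where K1: "stacked K1" "c \<notin> \<Union>K" "c \<in> \<Union>K1" "\<Union>K \<subseteq> \<Union>K1" "K - {{x, y, z}} \<subseteq> K1"
    "{c, x} \<in> edges K1" "{c, y} \<in> edges K1" "{c, z} \<in> edges K1"
    "{c, x, y} \<in> K1" "{c, y, z} \<in> K1" "{c, x, z} \<in> K1" "edges K \<subseteq> edges K1"
    by (rule obtain_stack[OF K xyz])
  have c: "c \<noteq> x" "c \<noteq> y" "c \<noteq> z" using K1(2) xyzK by blast+
  obtain c' K2 where K2: "stacked K2" "c' \<notin> \<Union>K1" "c' \<in> \<Union>K2" "\<Union>K1 \<subseteq> \<Union>K2" "K1 - {{c, x, y}} \<subseteq> K2"
    "{c', c} \<in> edges K2" "{c', x} \<in> edges K2" "{c', y} \<in> edges K2"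
    "{c', c, x} \<in> K2" "{c', x, y} \<in> K2" "{c', c, y} \<in> K2" "edges K1 \<subseteq> edges K2"
    by (rule obtain_stack[OF K1(1) K1(9) c(1) xyz(1) c(2)])
  have c': "c' \<noteq> c" "c' \<noteq> x" "c' \<noteq> y" "c' \<noteq> z" using K2(2) K1(3,4) xyzK by blast+
  obtain d K3 where K3: "stacked K3" "d \<notin> \<Union>K2" "d \<in> \<Union>K3" "\<Union>K2 \<subseteq> \<Union>K3" "K2 - {{c', c, x}} \<subseteq> K3"
    "{d, c'} \<in> edges K3" "{d, c} \<in> edges K3" "{d, x} \<in> edges K3"
    "{d, c', c} \<in> K3" "{d, c, x} \<in> K3" "{d, c', x} \<in> K3" "edges K2 \<subseteq> edges K3"
    by (rule obtain_stack[OF K2(1) K2(9) c'(1) c(1) c'(2)])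
  have "y \<notin> {c', c, x}" using c c' xyz by blast
  then have "{c', c, y} \<in> K3" using K2(11) K3(5) by blast
  from obtain_stack[OF K3(1) this c'(1) c(2) c'(3)]
  obtain e K4 where K4: "stacked K4" "e \<notin> \<Union>K3" "e \<in> \<Union>K4" "\<Union>K3 \<subseteq> \<Union>K4" "K3 - {{c', c, y}} \<subseteq> K4"
    "{e, c'} \<in> edges K4" "{e, c} \<in> edges K4" "{e, y} \<in> edges K4"
    "{e, c', c} \<in> K4" "{e, c, y} \<in> K4" "{e, c', y} \<in> K4" "edges K3 \<subseteq> edges K4"
    by this
  have E: "edges K1 \<subseteq> edges K4" "edges K2 \<subseteq> edges K4" "edges K3 \<subseteq> edges K4" "edges K \<subseteq> edges K4"
    by (intro order_trans[OF K1(12)] order_trans[OF K2(12)] order_trans[OF K3(12)] K4(12))+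
  have U2: "\<Union>K2 \<subseteq> \<Union>K4"
    by (rule order_trans[OF K3(4) K4(4)])
  have U1: "\<Union>K1 \<subseteq> \<Union>K4"
    by (rule order_trans[OF K2(4) U2])
  have U: "\<Union>K \<subseteq> \<Union>K4"
    by (rule order_trans[OF K1(4) U1])
  \<comment> \<open>The last two subdivided triangles contain both \<open>c\<close> and
    \<open>c'\<close>.\<close>
  have keep: "s \<in> K4" if "s \<in> K2" "c \<notin> s \<or> c' \<notin> s" for s
    using that K3(5) K4(5) by blast
  have old: "K - {{x, y, z}} \<subseteq> K4"
  proof
    fix s assume s: "s \<in> K - {{x, y, z}}"
    then have "c \<notin> s" using K1(2) by blast
    then show "s \<in> K4" using keep K1(5) K2(5) s by blast
  qed
  have xyc': "{x, y, c'} \<in> K4"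
    using keep[OF K2(10)] c c' by (simp add: insert_commute)
  have "z \<notin> {c, x, y}" using c xyz by blast
  then have "{c, x, z} \<in> K2" using K1(11) K2(5) by blast
  then have xzc: "{x, z, c} \<in> K4"
    using keep[of "{c, x, z}"] c c' by (simp add: insert_commute)
  have "c' \<notin> \<Union>K" using K2(2) K1(4) by blast
  have "y \<in> \<Union>K2" "x \<in> \<Union>K3" using xyzK K1(4) K2(4) K3(4) by blast+
  then have de: "d \<noteq> y" "e \<noteq> x" using K3(2) K4(2) by blast+
  have EE: "{c, x} \<in> edges K4" "{c, y} \<in> edges K4" "{c', c} \<in> edges K4" "{c', x} \<in> edges K4" "{c', y} \<in> edges K4"
    "{d, c'} \<in> edges K4" "{d, c} \<in> edges K4" "{d, x} \<in> edges K4"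
    using K1(6,7) K2(6,7,8) K3(6,7,8) E by blast+
  have swap: "{b, a} \<in> edges K4" if "{a, b} \<in> edges K4" for a b
    using that by (simp add: insert_commute)
  have "block (edges K4) x y {c, c'}"
    unfolding block_def
  proof (intro conjI)
    show "{c, c'} \<in> edges K4" by (rule swap[OF EE(3)])
    show "x \<notin> {c, c'}" "y \<notin> {c, c'}" using c c' by blast+
    show "\<forall>a\<in>{c, c'}. {x, a} \<in> edges K4 \<and> {y, a} \<in> edges K4"
      by (intro ballI conjI; elim insertE emptyE; hypsubst; rule swap; rule EE)
    show "\<exists>d. d \<noteq> y \<and> {x, d} \<in> edges K4 \<and> (\<forall>a\<in>{c, c'}. {a, d} \<in> edges K4)"
      by (intro exI[of _ d] conjI ballI de swap[OF EE(8)]; elim insertE emptyE; hypsubst; rule swap; rule EE)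
    show "\<exists>e. e \<noteq> x \<and> {y, e} \<in> edges K4 \<and> (\<forall>a\<in>{c, c'}. {a, e} \<in> edges K4)"
      by (intro exI[of _ e] conjI ballI de swap[OF K4(8)]; elim insertE emptyE; hypsubst; rule swap; rule K4)
  qed
  moreover have "c \<in> \<Union>K4" "c' \<in> \<Union>K4" using K1(3) K2(3) U1 U2 by blast+
  ultimately show ?thesis
    using that[OF K4(1) old E(4) U _ _ K1(2) \<open>c' \<notin> \<Union>K\<close> c'(1)[symmetric] _ xyc' xzc] by blast
qed

text \<open>The induction continues inside \<open>xyc'\<close>, with \<open>c'\<close> in the role
  of \<open>z\<close>; later blocks avoid all earlier vertices and so are disjoint. The face
  \<open>xzw\<close> keeps a triangle at the side \<open>xz\<close>, with \<open>w = y\<close> for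
  \<open>n = 0\<close> and \<open>w\<close> the vertex \<open>c\<close> of the first block
  otherwise.\<close>

lemma add_blocks:
  assumes "stacked K" "{x, y, z} \<in> K" "x \<noteq> y" "y \<noteq> z" "x \<noteq> z"
  shows "\<exists>K' P w. stacked K' \<and> K - {{x, y, z}} \<subseteq> K' \<and> edges K \<subseteq> edges K' \<and> \<Union>K \<subseteq> \<Union>K' \<and>
    finite P \<and> card P = n \<and> disjoint P \<and> (\<forall>f\<in>P. f \<inter> \<Union>K = {} \<and> block (edges K') x y f) \<and>
    {x, z, w} \<in> K' \<and> w \<noteq> x \<and> w \<noteq> z \<and> (w = y \<or> w \<notin> \<Union>K)"
  using assms
proof (induction n arbitrary: K z)
  case 0
  then have "{x, z, y} \<in> K" by (simp add: insert_commute)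
  then show ?case
    using 0 by (intro exI[of _ K] exI[of _ "{}"] exI[of _ y]) (auto simp: disjoint_def)
next
  case (Suc n)
  have xyzK: "x \<in> \<Union>K" "y \<in> \<Union>K" "z \<in> \<Union>K" using Suc.prems(2) by blast+
  from add_block[OF Suc.prems]
  obtain K1 c c' where K1: "stacked K1" "K - {{x, y, z}} \<subseteq> K1" "edges K \<subseteq> edges K1"
    "\<Union>K \<subseteq> \<Union>K1" "c \<in> \<Union>K1" "c' \<in> \<Union>K1" "c \<notin> \<Union>K" "c' \<notin> \<Union>K" "c \<noteq> c'"
    "block (edges K1) x y {c, c'}" "{x, y, c'} \<in> K1" "{x, z, c} \<in> K1"
    by this
  have ne: "y \<noteq> c'" "x \<noteq> c'" "c \<noteq> x" "c \<noteq> y" "c \<noteq> z" using xyzK K1(7,8) by blast+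
  obtain K2 P w where K2: "stacked K2" "K1 - {{x, y, c'}} \<subseteq> K2" "edges K1 \<subseteq> edges K2" "\<Union>K1 \<subseteq> \<Union>K2"
    "finite P" "card P = n" "disjoint P"
    and P: "\<forall>f\<in>P. f \<inter> \<Union>K1 = {} \<and> block (edges K2) x y f"
    using Suc.IH[OF K1(1) K1(11) Suc.prems(3) ne(1) ne(2)] by (elim exE conjE) (rule that)
  have "c \<notin> {x, y, c'}" using ne K1(9) by blast
  then have xzc: "{x, z, c} \<in> K2" using K1(12) K2(2) by blast
  have keep: "K - {{x, y, z}} \<subseteq> K2"
  proof
    fix s assume s: "s \<in> K - {{x, y, z}}"
    then have "c' \<notin> s" using K1(8) by blast
    then show "s \<in> K2" using s K1(2) K2(2) by blast
  qed
  have new: "{c, c'} \<inter> f = {}" if "f \<in> P" for f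
    using that P K1(5,6) by blast
  then have notin: "{c, c'} \<notin> P" by blast
  have dis: "disjoint (insert {c, c'} P)"
    using K2(7) new unfolding disjoint_def by (metis Int_commute insertE)
  have blk: "\<forall>f\<in>insert {c, c'} P. f \<inter> \<Union>K = {} \<and> block (edges K2) x y f"
  proof
    fix f assume f: "f \<in> insert {c, c'} P"
    show "f \<inter> \<Union>K = {} \<and> block (edges K2) x y f"
    proof (cases "f = {c, c'}")
      case True
      then show ?thesis using K1(7,8) block_mono[OF K1(10) K2(3)] by simp
    next
      case False
      then have "f \<inter> \<Union>K1 = {}" "block (edges K2) x y f" using f P by simp_all
      then show ?thesis using K1(4) by blast
    qed
  qed
  have "card (insert {c, c'} P) = Suc n" using notin K2(5,6) by simp
  moreover have "finite (insert {c, c'} P)" using K2(5) by simp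
  moreover have "edges K \<subseteq> edges K2" "\<Union>K \<subseteq> \<Union>K2"
    by (rule order_trans[OF K1(3) K2(3)], rule order_trans[OF K1(4) K2(4)])
  ultimately show ?case
    using K2(1) keep dis blk xzc ne(3,5) K1(7)
    by (intro exI[of _ K2] exI[of _ "insert {c, c'} P"] exI[of _ c] conjI disjI2)
qed

definition has_blocks :: "nat \<Rightarrow> 'a set set \<Rightarrow> 'a \<Rightarrow> 'a \<Rightarrow> bool" where
  "has_blocks n E x y \<longleftrightarrow> (\<exists>P. card P = n \<and> disjoint P \<and> (\<forall>f\<in>P. block E x y f))"

lemma has_blocksI:
  assumes "card P = n" "disjoint P" "\<And>f. f \<in> P \<Longrightarrow> block E x y f"
  shows "has_blocks n E x y"
  unfolding has_blocks_def using assms by (intro exI[of _ P]) simp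

lemma has_blocks_mono:
  assumes "has_blocks n E x y" "E \<subseteq> E'"
  shows "has_blocks n E' x y"
proof -
  obtain P where "card P = n" "disjoint P" "\<forall>f\<in>P. block E x y f"
    using assms(1) unfolding has_blocks_def by (elim exE conjE)
  then show ?thesis
    by (intro has_blocksI[of P]) (simp_all add: block_mono[OF _ assms(2)])
qed

lemma has_blocks_sym: "has_blocks n E x y \<Longrightarrow> has_blocks n E y x"
  unfolding has_blocks_def by (simp add: block_sym[of E x y])

text \<open>After the blocks for \<open>x, y\<close> the face \<open>xzw\<close> remains, and the
  blocks for \<open>x, z\<close> go there. One triangle thus serves two of its sides.\<close>

lemma add_blocks_two_sides:
  assumes K: "stacked K" "{x, y, z} \<in> K" "x \<noteq> y" "y \<noteq> z" "x \<noteq> z"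
  obtains K' where "stacked K'" "K - {{x, y, z}} \<subseteq> K'" "edges K \<subseteq> edges K'"
    "has_blocks n (edges K') x y" "has_blocks n (edges K') x z"
proof -
  obtain K1 P w where K1: "stacked K1" "K - {{x, y, z}} \<subseteq> K1" "edges K \<subseteq> edges K1"
    and P: "card P = n" "disjoint P" "\<forall>f\<in>P. f \<inter> \<Union>K = {} \<and> block (edges K1) x y f"
    and w: "{x, z, w} \<in> K1" "w \<noteq> x" "w \<noteq> z" "w = y \<or> w \<notin> \<Union>K"
    using add_blocks[OF K, of n] by (elim exE conjE) (rule that)
  obtain K2 P' where K2: "stacked K2" "K1 - {{x, z, w}} \<subseteq> K2" "edges K1 \<subseteq> edges K2"
    and P': "card P' = n" "disjoint P'" "\<forall>f\<in>P'. f \<inter> \<Union>K1 = {} \<and> block (edges K2) x z f"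
    using add_blocks[OF K1(1) w(1) K(5) w(3)[symmetric] w(2)[symmetric], of n]
    by (elim exE conjE) (rule that)
  \<comment> \<open>The second round uses up a face that is \<open>xyz\<close> itself or new, so no
    other member of \<open>K\<close> disappears.\<close>
  have "{x, z, w} = {x, y, z} \<or> {x, z, w} \<notin> K"
    using w(4) by (auto simp: insert_commute)
  then have keep: "K - {{x, y, z}} \<subseteq> K2" using K1(2) K2(2) by blast
  have "has_blocks n (edges K1) x y"
    using P by (intro has_blocksI[of P]) simp_all
  moreover have "has_blocks n (edges K2) x z"
    using P' by (intro has_blocksI[of P']) simp_all
  ultimately show ?thesis
    using has_blocks_mono[OF _ K2(3)] by (intro that[OF K2(1) keep order_trans[OF K1(3) K2(3)]])
qed

text \<open>Stacking \<open>d\<close> into the triangle gives a complete graph on four vertices. Its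
  six edges are shared out cyclically among the three inner faces: \<open>0d1\<close> serves
  \<open>0d\<close> and \<open>01\<close>, \<open>1d2\<close> serves \<open>1d\<close> and
  \<open>12\<close>, and \<open>2d0\<close> serves \<open>2d\<close> and \<open>20\<close>.\<close>

lemma stacked_K4_with_blocks:
  "\<exists>K Q. stacked K \<and> Q \<subseteq> \<Union>K \<and> card Q = 4 \<and>
    (\<forall>u\<in>Q. \<forall>v\<in>Q. u \<noteq> v \<longrightarrow> {u, v} \<in> edges K \<and> has_blocks n (edges K) u v)"
proof -
  have T: "stacked (Pow {0, 1, 2})" "{0, 1, 2} \<in> Pow {0, 1, 2 :: nat}"
    by (rule stacked.triangle) simp
  obtain d K0 where K0: "stacked K0" "d \<notin> \<Union>(Pow {0, 1, 2})" "d \<in> \<Union>K0"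
    "\<Union>(Pow {0, 1, 2}) \<subseteq> \<Union>K0" "Pow {0, 1, 2} - {{0, 1, 2}} \<subseteq> K0"
    "{d, 0} \<in> edges K0" "{d, 1} \<in> edges K0" "{d, 2} \<in> edges K0"
    "{d, 0, 1} \<in> K0" "{d, 1, 2} \<in> K0" "{d, 0, 2} \<in> K0" "edges (Pow {0, 1, 2}) \<subseteq> edges K0"
    by (rule obtain_stack[OF T]) simp_all
  have d: "d \<noteq> 0" "d \<noteq> 1" "d \<noteq> 2" "0 \<noteq> d" "1 \<noteq> d" "2 \<noteq> d" using K0(2) by auto
  have "{0, d, 1} \<in> K0" using K0(9) by (simp add: insert_commute)
  from add_blocks_two_sides[OF K0(1) this d(4) d(2)]
  obtain K1 where K1: "stacked K1" "K0 - {{0, d, 1}} \<subseteq> K1" "edges K0 \<subseteq> edges K1"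
    "has_blocks n (edges K1) 0 d" "has_blocks n (edges K1) 0 1" by auto
  have "2 \<notin> {0, d, 1}" using d by auto
  then have t1: "{d, 1, 2} \<in> K1" "{d, 0, 2} \<in> K1" using K0(10,11) K1(2) by blast+
  then have "{1, d, 2} \<in> K1" by (simp add: insert_commute)
  from add_blocks_two_sides[OF K1(1) this d(5) d(3)]
  obtain K2 where K2: "stacked K2" "K1 - {{1, d, 2}} \<subseteq> K2" "edges K1 \<subseteq> edges K2"
    "has_blocks n (edges K2) 1 d" "has_blocks n (edges K2) 1 2" by auto
  have "0 \<notin> {1, d, 2}" using d by auto
  then have "{d, 0, 2} \<in> K2" using t1 K2(2) by blast
  then have "{2, d, 0} \<in> K2" by (simp add: insert_commute)
  from add_blocks_two_sides[OF K2(1) this d(6) d(1)]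
  obtain K3 where K3: "stacked K3" "K2 - {{2, d, 0}} \<subseteq> K3" "edges K2 \<subseteq> edges K3"
    "has_blocks n (edges K3) 2 d" "has_blocks n (edges K3) 2 0" by auto
  have E13: "edges K1 \<subseteq> edges K3" by (rule order_trans[OF K2(3) K3(3)])
  have E03: "edges K0 \<subseteq> edges K3" by (rule order_trans[OF K1(3) E13])
  have e0: "{0, 1} \<in> edges (Pow {0, 1, 2 :: nat})" "{1, 2} \<in> edges (Pow {0, 1, 2 :: nat})"
    "{2, 0} \<in> edges (Pow {0, 1, 2 :: nat})" by simp_all
  have e: "{0, 1} \<in> edges K3" "{1, 2} \<in> edges K3" "{2, 0} \<in> edges K3"
    "{d, 0} \<in> edges K3" "{d, 1} \<in> edges K3" "{d, 2} \<in> edges K3"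
    by (intro subsetD[OF E03] subsetD[OF K0(12)] e0 K0(6-8))+
  note b = has_blocks_mono[OF K1(4) E13] has_blocks_mono[OF K1(5) E13]
    has_blocks_mono[OF K2(4) K3(3)] has_blocks_mono[OF K2(5) K3(3)] K3(4,5)
  let ?good = "\<lambda>u v. {u, v} \<in> edges K3 \<and> has_blocks n (edges K3) u v"
  have sym: "?good v u" if "?good u v" for u v
    using that has_blocks_sym[of n "edges K3" u v] by (simp add: insert_commute)
  have g: "?good 0 1" "?good 1 2" "?good 2 0" "?good d 0" "?good d 1" "?good d 2"
    by (intro conjI e b has_blocks_sym[OF b(1)] has_blocks_sym[OF b(3)] has_blocks_sym[OF b(5)])+
  have "?good u v" if "u \<in> {0, 1, 2, d}" "v \<in> {0, 1, 2, d}" "u \<noteq> v" for u v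
    using that g sym[OF g(1)] sym[OF g(2)] sym[OF g(3)] sym[OF g(4)] sym[OF g(5)] sym[OF g(6)]
    by (elim insertE emptyE) (hypsubst, (assumption | (erule notE, rule refl)))+
  moreover have "card {0, 1, 2, d} = 4" using d by simp
  moreover have "{0, 1, 2, d} \<subseteq> \<Union>K3" using e by blast
  ultimately show ?thesis
    using K3(1) by (intro exI[of _ K3] exI[of _ "{0, 1, 2, d}"]) simp
qed

theorem theorem2:
  shows "\<exists>(V :: nat set) E. simple_graph V E \<and> planar V E \<and> local_page_number V E = 3"
proof -
  obtain K Q where K: "stacked K" and Q: "Q \<subseteq> \<Union>K" "card Q = 4"
    and good: "\<forall>u\<in>Q. \<forall>v\<in>Q. u \<noteq> v \<longrightarrow> {u, v} \<in> edges K \<and> has_blocks 9 (edges K) u v"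
    using stacked_K4_with_blocks[of 9] by (elim exE conjE) (rule that)
  obtain pos where fin: "finite (\<Union>K)" and pos: "realizes pos K"
    using stacked_realizable[OF K] by blast
  have G: "simple_graph (\<Union>K) (edges K)"
    using fin unfolding simple_graph_def by blast
  have "finite K" using fin by (rule finite_UnionD)
  then have fE: "finite (edges K)" by simp
  have no: "\<not> k_local_book_embedding 2 (\<Union>K) (edges K) ord page" for ord page
  proof
    assume emb: "k_local_book_embedding 2 (\<Union>K) (edges K) ord page"
    \<comment> \<open>Which pair shares its pages depends on the embedding, so every pair in
      \<open>Q\<close> was given nine blocks.\<close>
    obtain x y p q where xy: "x \<in> Q" "y \<in> Q" "x \<noteq> y"
      and pq: "pages_at (edges K) page x \<subseteq> {p, q}" "pages_at (edges K) page y \<subseteq> {p, q}"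
      using K4_pages[OF emb fE Q] good by blast
    have "has_blocks 9 (edges K) x y"
      using good xy by blast
    then obtain P where P: "card P = 9" "disjoint P" "\<forall>f\<in>P. block (edges K) x y f"
      unfolding has_blocks_def by (elim exE conjE)
    have "x \<in> \<Union>K" "y \<in> \<Union>K"
      using xy Q(1) by blast+
    then show False
      using P by (intro blocks_impossible[OF emb G pq xy(3) _ _ P(1,2)]) simp_all
  qed
  have "3 \<le> local_page_number (\<Union>K) (edges K)"
  proof (rule ccontr)
    assume small: "\<not> ?thesis"
    obtain k where "\<exists>ord page. k_local_book_embedding k (\<Union>K) (edges K) ord page"
      using k_local_book_embedding_exists[OF fE, of "\<Union>K"] by (elim exE) (rule that, intro exI)
    from local_page_number_attained[OF this] obtain ord page where
      emb: "k_local_book_embedding (local_page_number (\<Union>K) (edges K)) (\<Union>K) (edges K) ord page"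
      by (elim exE)
    have "k_local_book_embedding 2 (\<Union>K) (edges K) ord page"
      using emb small unfolding k_local_book_embedding_def by fastforce
    then show False using no by simp
  qed
  \<comment> \<open>Only edges are deleted; the vertex set and the drawing of the remaining edges
    stay the same.\<close>
  then obtain F where F: "F \<subseteq> edges K" "local_page_number (\<Union>K) F = 3"
    using local_page_number_intermediate[OF fE] by blast
  have "simple_graph (\<Union>K) F"
    using G F(1) unfolding simple_graph_def by blast
  then show ?thesis
    using realizes_imp_planar[OF pos F(1)] F(2) by blast
qed

end
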